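(* ($3\times 3$ Lemma) Let $\mathcal{C}$ be a strongly right exact category and consider a commutative diagram in $\mathcal{C}$ with rows $$A\xrightarrow{i}B\xrightarrow{d}C,\qquad A'\xrightarrow{i'}B'\xrightarrow{d'}C',\qquad A''\xrightarrow{i''}B''\xrightarrow{d''}C''$$ and columns $$A\xrightarrow{f}A'\xrightarrow{f'}A'',\qquad B\xrightarrow{g}B'\xrightarrow{g'}B'',\qquad C\xrightarrow{h}C'\xrightarrow{h'}C''$$ (so $gi=i'f$, $hd=d'g$, $g'i'=i''f'$, $h'd'=d''g'$), in which the three columns and the first two rows are conflations. Then the third row $A''\xrightarrow{i''}B''\xrightarrow{d''}C''$ is also a conflation.
   Context: A right exact category is an additive category endowed with a distinguished class of kernels (morphisms that are kernels of some morphism), called inflations, such that: [R0] the identity morphism $1_0:0\to 0$ is an inflation; [R1] the composition of any two inflations is an inflation; [R2] the pushout of any inflation along an arbitrary morphism exists and is again an inflation. By [R2] (pushout along $A\to 0$), every inflation $i:A\to B$ has a cokernel $d:B\to C$; such a $d$ is called a deflation, and $A\xrightarrow{i}B\xrightarrow{d}C$ (which is a kernel-cokernel pair) is called a conflation. A right exact category is strongly right exact if moreover: [R3] if $i:A\to B$ and $p:B\to C$ are morphisms such that $i$ has a cokernel and $pi$ is an inflation, then $i$ is an inflation. *)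

theory Defs
  imports "HOL-Algebra.Group"
begin

record ('o, 'm) category =
  Ob :: "'o set"
  Mor :: "'m set"
  Dom :: "'m \<Rightarrow> 'o"
  Cod :: "'m \<Rightarrow> 'o"
  idm :: "'o \<Rightarrow> 'm"
  Cmp :: "'m \<Rightarrow> 'm \<Rightarrow> 'm"  (infixr "\<cdot>\<index>" 70)

definition Hom :: "('o, 'm, 'x) category_scheme \<Rightarrow> 'o \<Rightarrow> 'o \<Rightarrow> 'm set"
  where "Hom \<C> A B = {f \<in> Mor \<C>. Dom \<C> f = A \<and> Cod \<C> f = B}"

text \<open>Composition is written in the usual order, \<open>g \<cdot> f\<close> being \<open>f\<close> followed by \<open>g\<close>.\<close>

locale category =
  fixes \<C> :: "('o, 'm, 'x) category_scheme" (structure)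
  assumes Dom_in: "f \<in> Mor \<C> \<Longrightarrow> Dom \<C> f \<in> Ob \<C>"
    and Cod_in: "f \<in> Mor \<C> \<Longrightarrow> Cod \<C> f \<in> Ob \<C>"
    and idm_in: "A \<in> Ob \<C> \<Longrightarrow> idm \<C> A \<in> Hom \<C> A A"
    and Cmp_in: "\<lbrakk>f \<in> Hom \<C> A B; g \<in> Hom \<C> B D\<rbrakk> \<Longrightarrow> g \<cdot> f \<in> Hom \<C> A D"
    and idm_left: "f \<in> Hom \<C> A B \<Longrightarrow> idm \<C> B \<cdot> f = f"
    and idm_right: "f \<in> Hom \<C> A B \<Longrightarrow> f \<cdot> idm \<C> A = f"
    and Cmp_assoc: "\<lbrakk>f \<in> Hom \<C> A B; g \<in> Hom \<C> B D; h \<in> Hom \<C> D E\<rbrakk>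
      \<Longrightarrow> (h \<cdot> g) \<cdot> f = h \<cdot> (g \<cdot> f)"

record ('o, 'm) preadditive_category = "('o, 'm) category" +
  Add :: "'m \<Rightarrow> 'm \<Rightarrow> 'm"  (infixl "\<oplus>\<index>" 65)
  zm :: "'o \<Rightarrow> 'o \<Rightarrow> 'm"

definition Hom_group :: "('o, 'm, 'x) preadditive_category_scheme \<Rightarrow> 'o \<Rightarrow> 'o \<Rightarrow> 'm monoid"
  where "Hom_group \<C> A B = \<lparr>carrier = Hom \<C> A B, monoid.mult = Add \<C>, one = zm \<C> A B\<rparr>"

locale preadditive_category = category \<C>
  for \<C> :: "('o, 'm, 'x) preadditive_category_scheme" (structure) +
  assumes Hom_comm_group: "\<lbrakk>A \<in> Ob \<C>; B \<in> Ob \<C>\<rbrakk> \<Longrightarrow> comm_group (Hom_group \<C> A B)"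
    and Cmp_Add_left: "\<lbrakk>f \<in> Hom \<C> A B; g \<in> Hom \<C> B D; g' \<in> Hom \<C> B D\<rbrakk>
      \<Longrightarrow> (g \<oplus> g') \<cdot> f = (g \<cdot> f) \<oplus> (g' \<cdot> f)"
    and Cmp_Add_right: "\<lbrakk>f \<in> Hom \<C> A B; f' \<in> Hom \<C> A B; g \<in> Hom \<C> B D\<rbrakk>
      \<Longrightarrow> g \<cdot> (f \<oplus> f') = (g \<cdot> f) \<oplus> (g \<cdot> f')"

definition is_zero_object :: "('o, 'm, 'x) category_scheme \<Rightarrow> 'o \<Rightarrow> bool"
  where "is_zero_object \<C> Z \<longleftrightarrow> Z \<in> Ob \<C> \<and>
    (\<forall>A \<in> Ob \<C>. (\<exists>!f. f \<in> Hom \<C> A Z) \<and> (\<exists>!f. f \<in> Hom \<C> Z A))"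

definition is_biproduct ::
    "('o, 'm, 'x) preadditive_category_scheme \<Rightarrow> 'o \<Rightarrow> 'o \<Rightarrow> 'o \<Rightarrow> 'm \<Rightarrow> 'm \<Rightarrow> 'm \<Rightarrow> 'm \<Rightarrow> bool"
  where "is_biproduct \<C> A B S j k p q \<longleftrightarrow>
    j \<in> Hom \<C> A S \<and> k \<in> Hom \<C> B S \<and> p \<in> Hom \<C> S A \<and> q \<in> Hom \<C> S B \<and>
    p \<cdot>\<^bsub>\<C>\<^esub> j = idm \<C> A \<and> q \<cdot>\<^bsub>\<C>\<^esub> k = idm \<C> B \<and>
    q \<cdot>\<^bsub>\<C>\<^esub> j = zm \<C> A B \<and> p \<cdot>\<^bsub>\<C>\<^esub> k = zm \<C> B A \<and>
    (j \<cdot>\<^bsub>\<C>\<^esub> p) \<oplus>\<^bsub>\<C>\<^esub> (k \<cdot>\<^bsub>\<C>\<^esub> q) = idm \<C> S"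

locale additive_category = preadditive_category \<C>
  for \<C> :: "('o, 'm, 'x) preadditive_category_scheme" (structure) +
  assumes zero_object_exists: "\<exists>Z. is_zero_object \<C> Z"
    and biproduct_exists: "\<lbrakk>A \<in> Ob \<C>; B \<in> Ob \<C>\<rbrakk> \<Longrightarrow> \<exists>S j k p q. is_biproduct \<C> A B S j k p q"

definition is_kernel :: "('o, 'm, 'x) preadditive_category_scheme \<Rightarrow> 'm \<Rightarrow> 'm \<Rightarrow> bool"
  where "is_kernel \<C> k f \<longleftrightarrow>
    k \<in> Mor \<C> \<and> f \<in> Mor \<C> \<and> Cod \<C> k = Dom \<C> f \<and>
    f \<cdot>\<^bsub>\<C>\<^esub> k = zm \<C> (Dom \<C> k) (Cod \<C> f) \<and>
    (\<forall>t \<in> Mor \<C>. Cod \<C> t = Dom \<C> f \<and> f \<cdot>\<^bsub>\<C>\<^esub> t = zm \<C> (Dom \<C> t) (Cod \<C> f) \<longrightarrow>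
      (\<exists>!u. u \<in> Hom \<C> (Dom \<C> t) (Dom \<C> k) \<and> k \<cdot>\<^bsub>\<C>\<^esub> u = t))"

definition is_cokernel :: "('o, 'm, 'x) preadditive_category_scheme \<Rightarrow> 'm \<Rightarrow> 'm \<Rightarrow> bool"
  where "is_cokernel \<C> c f \<longleftrightarrow>
    c \<in> Mor \<C> \<and> f \<in> Mor \<C> \<and> Dom \<C> c = Cod \<C> f \<and>
    c \<cdot>\<^bsub>\<C>\<^esub> f = zm \<C> (Dom \<C> f) (Cod \<C> c) \<and>
    (\<forall>t \<in> Mor \<C>. Dom \<C> t = Cod \<C> f \<and> t \<cdot>\<^bsub>\<C>\<^esub> f = zm \<C> (Dom \<C> f) (Cod \<C> t) \<longrightarrow>
      (\<exists>!u. u \<in> Hom \<C> (Cod \<C> c) (Cod \<C> t) \<and> u \<cdot>\<^bsub>\<C>\<^esub> c = t))"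

text \<open>\<open>is_pushout \<C> i f i' f'\<close>: \<open>i'\<close> is the pushout of \<open>i\<close> along \<open>f\<close>, in the square
  \<open>f' \<cdot> i = i' \<cdot> f\<close>.\<close>

definition is_pushout ::
    "('o, 'm, 'x) category_scheme \<Rightarrow> 'm \<Rightarrow> 'm \<Rightarrow> 'm \<Rightarrow> 'm \<Rightarrow> bool"
  where "is_pushout \<C> i f i' f' \<longleftrightarrow>
    i \<in> Mor \<C> \<and> f \<in> Mor \<C> \<and> i' \<in> Mor \<C> \<and> f' \<in> Mor \<C> \<and>
    Dom \<C> f = Dom \<C> i \<and> Dom \<C> i' = Cod \<C> f \<and> Dom \<C> f' = Cod \<C> i \<and> Cod \<C> i' = Cod \<C> f' \<and>
    f' \<cdot>\<^bsub>\<C>\<^esub> i = i' \<cdot>\<^bsub>\<C>\<^esub> f \<and>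
    (\<forall>s \<in> Mor \<C>. \<forall>t \<in> Mor \<C>.
      Dom \<C> s = Cod \<C> f \<and> Dom \<C> t = Cod \<C> i \<and> Cod \<C> s = Cod \<C> t \<and>
      t \<cdot>\<^bsub>\<C>\<^esub> i = s \<cdot>\<^bsub>\<C>\<^esub> f \<longrightarrow>
      (\<exists>!u. u \<in> Hom \<C> (Cod \<C> i') (Cod \<C> s) \<and> u \<cdot>\<^bsub>\<C>\<^esub> i' = s \<and> u \<cdot>\<^bsub>\<C>\<^esub> f' = t))"

text \<open>A pushout is only determined up to isomorphism, so closure under pushouts is
  required for every choice of the pushout; likewise \<open>R0\<close> is required for every zero object.\<close>

locale right_exact_category = additive_category \<C>
  for \<C> :: "('o, 'm, 'x) preadditive_category_scheme" (structure) +
  fixes Infl :: "'m set"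
  assumes inflation_is_kernel: "i \<in> Infl \<Longrightarrow> \<exists>f. is_kernel \<C> i f"
    and R0: "is_zero_object \<C> Z \<Longrightarrow> idm \<C> Z \<in> Infl"
    and R1: "\<lbrakk>i \<in> Infl; j \<in> Infl; Cod \<C> i = Dom \<C> j\<rbrakk> \<Longrightarrow> j \<cdot> i \<in> Infl"
    and R2_exists: "\<lbrakk>i \<in> Infl; f \<in> Mor \<C>; Dom \<C> f = Dom \<C> i\<rbrakk> \<Longrightarrow> \<exists>i' f'. is_pushout \<C> i f i' f'"
    and R2_inflation: "\<lbrakk>i \<in> Infl; is_pushout \<C> i f i' f'\<rbrakk> \<Longrightarrow> i' \<in> Infl"

locale strongly_right_exact_category = right_exact_category \<C> Infl
  for \<C> :: "('o, 'm, 'x) preadditive_category_scheme" (structure) and Infl :: "'m set" +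
  assumes R3: "\<lbrakk>i \<in> Hom \<C> A B; p \<in> Hom \<C> B D; \<exists>c. is_cokernel \<C> c i; p \<cdot> i \<in> Infl\<rbrakk>
    \<Longrightarrow> i \<in> Infl"

text \<open>In a right exact category, \<open>conflation \<C> Infl i d\<close> forces \<open>(i, d)\<close> to be a
  kernel-cokernel pair, since a kernel is a kernel of its cokernel whenever the latter exists.\<close>

definition conflation ::
    "('o, 'm, 'x) preadditive_category_scheme \<Rightarrow> 'm set \<Rightarrow> 'm \<Rightarrow> 'm \<Rightarrow> bool"
  where "conflation \<C> Infl i d \<longleftrightarrow> i \<in> Infl \<and> is_cokernel \<C> d i"

end

theory Submission
  imports Defs
begin

text \<open>
  That \<open>d''\<close> is a cokernel of \<open>i''\<close> is a diagram chase. For the inflation property, let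
  \<open>j: A'' \<rightarrow> P\<close> be the pushout of \<open>i'\<close> along \<open>f'\<close>, and let \<open>e: P \<rightarrow> C'\<close> and \<open>r: P \<rightarrow> B''\<close> be the
  induced morphisms, so that \<open>e j = 0\<close> and \<open>r j = i''\<close>. There is \<open>m: C \<rightarrow> P\<close> with \<open>e m = h\<close> of which
  \<open>r\<close> is a cokernel, and hence \<open>(r, e): P \<rightarrow> B'' \<oplus> C'\<close> is the pushout of the inflation \<open>h\<close> along \<open>m\<close>.
  Thus \<open>(r, e) j = (i'', 0)\<close> is an inflation that factors through \<open>i''\<close>, and \<open>[R3]\<close> applies.
\<close>

section \<open>Universal properties in terms of Hom sets\<close>

lemma HomD:
  assumes "f \<in> Hom \<C> A B"
  shows "f \<in> Mor \<C>" "Dom \<C> f = A" "Cod \<C> f = B"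
  using assms by (auto simp: Hom_def)

text \<open>Rewriting \<open>Dom\<close> and \<open>Cod\<close> in the definition to the named
  objects lets all later chases work with Hom sets alone.\<close>

lemma is_cokernelD:
  fixes \<C> (structure)
  assumes "is_cokernel \<C> c f" "f \<in> Hom \<C> A B" "c \<in> Hom \<C> B C"
  shows is_cokernel_zero: "c \<cdot> f = zm \<C> A C"
    and is_cokernel_universal:
      "\<lbrakk>t \<in> Hom \<C> B T; t \<cdot> f = zm \<C> A T\<rbrakk> \<Longrightarrow> \<exists>!u. u \<in> Hom \<C> C T \<and> u \<cdot> c = t"
proof -
  note univ = assms(1)[unfolded is_cokernel_def HomD[OF assms(2)] HomD[OF assms(3)]]
  from univ show "c \<cdot> f = zm \<C> A C" by blast
  show "\<exists>!u. u \<in> Hom \<C> C T \<and> u \<cdot> c = t" if t: "t \<in> Hom \<C> B T" "t \<cdot> f = zm \<C> A T"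
  proof -
    have "\<forall>t \<in> Mor \<C>. Dom \<C> t = B \<and> t \<cdot> f = zm \<C> A (Cod \<C> t) \<longrightarrow>
        (\<exists>!u. u \<in> Hom \<C> C (Cod \<C> t) \<and> u \<cdot> c = t)"
      using univ by (elim conjE)
    from bspec[OF this HomD(1)[OF t(1)]] show ?thesis
      unfolding HomD[OF t(1)] using t(2) by (elim mp) simp
  qed
qed

lemma is_cokernel_factor:
  fixes \<C> (structure)
  assumes "is_cokernel \<C> c f" "f \<in> Hom \<C> A B" "c \<in> Hom \<C> B C"
    and "t \<in> Hom \<C> B T" "t \<cdot> f = zm \<C> A T"
  shows "\<exists>u \<in> Hom \<C> C T. u \<cdot> c = t"
  using ex1_implies_ex[OF is_cokernel_universal[OF assms]] by blast

lemma is_pushoutD: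
  fixes \<C> (structure)
  assumes "is_pushout \<C> i f i' f'" "i \<in> Hom \<C> A B" "f \<in> Hom \<C> A D"
  shows is_pushout_Hom: "i' \<in> Hom \<C> D (Cod \<C> i')" "f' \<in> Hom \<C> B (Cod \<C> i')"
    and is_pushout_commutes: "f' \<cdot> i = i' \<cdot> f"
    and is_pushout_universal:
      "\<lbrakk>s \<in> Hom \<C> D T; t \<in> Hom \<C> B T; t \<cdot> i = s \<cdot> f\<rbrakk>
        \<Longrightarrow> \<exists>!u. u \<in> Hom \<C> (Cod \<C> i') T \<and> u \<cdot> i' = s \<and> u \<cdot> f' = t"
proof -
  note univ = assms(1)[unfolded is_pushout_def HomD[OF assms(2)] HomD[OF assms(3)]]
  from univ have m: "i' \<in> Mor \<C> \<and> f' \<in> Mor \<C> \<and> Dom \<C> i' = D \<and> Dom \<C> f' = B \<and>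
      Cod \<C> i' = Cod \<C> f'" by (elim conjE) (intro conjI)
  then show "i' \<in> Hom \<C> D (Cod \<C> i')" "f' \<in> Hom \<C> B (Cod \<C> i')"
    by (simp_all add: Hom_def)
  from univ show "f' \<cdot> i = i' \<cdot> f" by (elim conjE)
  show "\<exists>!u. u \<in> Hom \<C> (Cod \<C> i') T \<and> u \<cdot> i' = s \<and> u \<cdot> f' = t"
    if st: "s \<in> Hom \<C> D T" "t \<in> Hom \<C> B T" "t \<cdot> i = s \<cdot> f"
  proof -
    have "\<forall>s \<in> Mor \<C>. \<forall>t \<in> Mor \<C>. Dom \<C> s = D \<and> Dom \<C> t = B \<and> Cod \<C> s = Cod \<C> t \<and>
        t \<cdot> i = s \<cdot> f \<longrightarrow> (\<exists>!u. u \<in> Hom \<C> (Cod \<C> i') (Cod \<C> s) \<and> u \<cdot> i' = s \<and> u \<cdot> f' = t)"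
      using univ by (elim conjE)
    from bspec[OF bspec[OF this HomD(1)[OF st(1)]] HomD(1)[OF st(2)]] show ?thesis
      unfolding HomD[OF st(1)] HomD[OF st(2)] using st(3) by (elim mp) simp
  qed
qed

lemma is_pushoutI:
  fixes \<C> (structure)
  assumes "i \<in> Hom \<C> A B" "f \<in> Hom \<C> A D" "i' \<in> Hom \<C> D E" "f' \<in> Hom \<C> B E"
    and "f' \<cdot> i = i' \<cdot> f"
    and univ: "\<And>s t T. \<lbrakk>s \<in> Hom \<C> D T; t \<in> Hom \<C> B T; t \<cdot> i = s \<cdot> f\<rbrakk>
        \<Longrightarrow> \<exists>!u. u \<in> Hom \<C> E T \<and> u \<cdot> i' = s \<and> u \<cdot> f' = t"
  shows "is_pushout \<C> i f i' f'"
  unfolding is_pushout_def HomD[OF assms(1)] HomD[OF assms(2)] HomD[OF assms(3)] HomD[OF assms(4)]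
  by (intro conjI ballI impI HomD[OF assms(1)] HomD[OF assms(2)] HomD[OF assms(3)] HomD[OF assms(4)]
        refl assms(5) univ; elim conjE; simp add: Hom_def)

context preadditive_category
begin

section \<open>Addition and zero morphisms\<close>

lemma Hom_Ob:
  assumes "f \<in> Hom \<C> A B"
  shows "A \<in> Ob \<C>" "B \<in> Ob \<C>"
  using assms Dom_in Cod_in by (auto simp: Hom_def)

lemma zm_in: "\<lbrakk>A \<in> Ob \<C>; B \<in> Ob \<C>\<rbrakk> \<Longrightarrow> zm \<C> A B \<in> Hom \<C> A B"
  using Hom_comm_group[of A B]
  by (auto simp: Hom_group_def comm_group_def comm_monoid_def dest!: monoid.one_closed)

lemma Add_in: "\<lbrakk>a \<in> Hom \<C> A B; b \<in> Hom \<C> A B\<rbrakk> \<Longrightarrow> a \<oplus> b \<in> Hom \<C> A B"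
  using Hom_comm_group[of A B] Hom_Ob[of a A B] monoid.m_closed[of "Hom_group \<C> A B" a b]
  by (auto simp: Hom_group_def comm_group_def comm_monoid_def)

lemma zm_Add: "a \<in> Hom \<C> A B \<Longrightarrow> zm \<C> A B \<oplus> a = a"
  using Hom_comm_group[of A B] Hom_Ob[of a A B] monoid.l_one[of "Hom_group \<C> A B" a]
  by (auto simp: Hom_group_def comm_group_def comm_monoid_def)

lemma Add_zm: "a \<in> Hom \<C> A B \<Longrightarrow> a \<oplus> zm \<C> A B = a"
  using Hom_comm_group[of A B] Hom_Ob[of a A B] monoid.r_one[of "Hom_group \<C> A B" a]
  by (auto simp: Hom_group_def comm_group_def comm_monoid_def)

lemma Add_right_cancel:
  "\<lbrakk>a \<in> Hom \<C> A B; b \<in> Hom \<C> A B; c \<in> Hom \<C> A B; a \<oplus> c = b \<oplus> c\<rbrakk> \<Longrightarrow> a = b"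
  using Hom_comm_group[of A B] Hom_Ob[of a A B] group.right_cancel[of "Hom_group \<C> A B" c a b]
  by (auto simp: Hom_group_def comm_group_def)

text \<open>The category record carries addition and zero but no negation, so a - b is built from
  the inverse in the Hom group and exported only through its defining equation.\<close>

lemma Add_difference:
  assumes "a \<in> Hom \<C> A B" "b \<in> Hom \<C> A B"
  obtains x where "x \<in> Hom \<C> A B" "x \<oplus> b = a"
proof -
  interpret G: comm_group "Hom_group \<C> A B"
    using Hom_comm_group Hom_Ob[OF assms(1)] by blast
  let ?x = "a \<otimes>\<^bsub>Hom_group \<C> A B\<^esub> inv\<^bsub>Hom_group \<C> A B\<^esub> b"
  have ab: "a \<in> carrier (Hom_group \<C> A B)" "b \<in> carrier (Hom_group \<C> A B)"
    using assms by (simp_all add: Hom_group_def)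
  then have "?x \<otimes>\<^bsub>Hom_group \<C> A B\<^esub> b = a" "?x \<in> carrier (Hom_group \<C> A B)"
    by (simp_all add: G.m_assoc)
  with that show thesis by (simp add: Hom_group_def)
qed

lemma zm_Cmp:
  assumes f: "f \<in> Hom \<C> A B" and D: "D \<in> Ob \<C>"
  shows "zm \<C> B D \<cdot> f = zm \<C> A D"
proof -
  have z: "zm \<C> B D \<in> Hom \<C> B D" and z': "zm \<C> A D \<in> Hom \<C> A D"
    using zm_in Hom_Ob[OF f] D by blast+
  have zf: "zm \<C> B D \<cdot> f \<in> Hom \<C> A D" using Cmp_in[OF f z] .
  \<comment> \<open>Distributivity applied to 0 + 0 = 0 makes the composite idempotent under
    addition; cancelling one copy shows that it is zero.\<close>
  have "zm \<C> B D \<cdot> f \<oplus> zm \<C> B D \<cdot> f = zm \<C> A D \<oplus> zm \<C> B D \<cdot> f"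
    using Cmp_Add_left[OF f z z] zm_Add[OF z] zm_Add[OF zf] by simp
  with zf z' show ?thesis by (blast intro: Add_right_cancel)
qed

lemma Cmp_zm:
  assumes g: "g \<in> Hom \<C> B D" and A: "A \<in> Ob \<C>"
  shows "g \<cdot> zm \<C> A B = zm \<C> A D"
proof -
  have z: "zm \<C> A B \<in> Hom \<C> A B" and z': "zm \<C> A D \<in> Hom \<C> A D"
    using zm_in Hom_Ob[OF g] A by blast+
  have gz: "g \<cdot> zm \<C> A B \<in> Hom \<C> A D" using Cmp_in[OF z g] .
  have "g \<cdot> zm \<C> A B \<oplus> g \<cdot> zm \<C> A B = zm \<C> A D \<oplus> g \<cdot> zm \<C> A B"
    using Cmp_Add_right[OF z z g] zm_Add[OF z] zm_Add[OF gz] by simp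
  with gz z' show ?thesis by (blast intro: Add_right_cancel)
qed

text \<open>The common composite with \<open>c\<close> kills \<open>f\<close>, so \<open>u\<close>
  and \<open>v\<close> are both its unique factorisation through \<open>c\<close>.\<close>

lemma is_cokernel_epi:
  assumes cok: "is_cokernel \<C> c f" and f: "f \<in> Hom \<C> A B" and c: "c \<in> Hom \<C> B C"
    and u: "u \<in> Hom \<C> C T" and v: "v \<in> Hom \<C> C T" and eq: "u \<cdot> c = v \<cdot> c"
  shows "u = v"
proof -
  have uc: "u \<cdot> c \<in> Hom \<C> B T" using Cmp_in[OF c u] .
  have "(u \<cdot> c) \<cdot> f = zm \<C> A T"
    using Cmp_assoc[OF f c u] is_cokernel_zero[OF cok f c] Cmp_zm[OF u] Hom_Ob[OF f] by simp
  from is_cokernel_universal[OF cok f c uc this] show ?thesis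
    using u v eq by (auto elim!: ex1E)
qed

text \<open>Unique factorisation is split into existence and right cancellation of \<open>c\<close>,
  the two things that a diagram chase delivers separately.\<close>

lemma is_cokernelI:
  assumes "f \<in> Hom \<C> A B" "c \<in> Hom \<C> B C" "c \<cdot> f = zm \<C> A C"
    and "\<And>t T. \<lbrakk>t \<in> Hom \<C> B T; t \<cdot> f = zm \<C> A T\<rbrakk> \<Longrightarrow> \<exists>u \<in> Hom \<C> C T. u \<cdot> c = t"
    and "\<And>u v T. \<lbrakk>u \<in> Hom \<C> C T; v \<in> Hom \<C> C T; u \<cdot> c = v \<cdot> c\<rbrakk> \<Longrightarrow> u = v"
  shows "is_cokernel \<C> c f"
proof -
  have "\<exists>!u. u \<in> Hom \<C> C (Cod \<C> t) \<and> u \<cdot> c = t"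
    if t: "t \<in> Mor \<C>" "Dom \<C> t = B" "t \<cdot> f = zm \<C> A (Cod \<C> t)" for t
  proof -
    from t have "t \<in> Hom \<C> B (Cod \<C> t)" by (simp add: Hom_def)
    from assms(4)[OF this t(3)] obtain u where "u \<in> Hom \<C> C (Cod \<C> t)" "u \<cdot> c = t" ..
    then show ?thesis by (intro ex1I[of _ u]) (auto intro: assms(5))
  qed
  with assms(1-3) show ?thesis unfolding is_cokernel_def by (simp add: HomD)
qed

text \<open>With \<open>(p, q)\<close> the projections of the biproduct \<open>S\<close> of \<open>R\<close> and \<open>D\<close>, the inclusion of \<open>D\<close> and
  \<open>(r, e): P \<rightarrow> S\<close> complete \<open>m\<close> and \<open>h = e m\<close> to a pushout square.\<close>

lemma is_pushout_cokernel_biproduct: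
  assumes m: "m \<in> Hom \<C> C P" and e: "e \<in> Hom \<C> P D" and r: "r \<in> Hom \<C> P R"
    and cok: "is_cokernel \<C> r m"
    and bip: "is_biproduct \<C> R D S k l p q"
  shows "is_pushout \<C> (e \<cdot> m) m ((k \<cdot> r) \<oplus> (l \<cdot> e)) l"
proof -
  from bip have k: "k \<in> Hom \<C> R S" and l: "l \<in> Hom \<C> D S"
    and p: "p \<in> Hom \<C> S R" and q: "q \<in> Hom \<C> S D"
    and pk: "p \<cdot> k = idm \<C> R" and ql: "q \<cdot> l = idm \<C> D"
    and qk: "q \<cdot> k = zm \<C> R D" and pl: "p \<cdot> l = zm \<C> D R"
    and sum: "(k \<cdot> p) \<oplus> (l \<cdot> q) = idm \<C> S"
    unfolding is_biproduct_def by auto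
  note ob = Hom_Ob[OF m] Hom_Ob[OF k] Hom_Ob[OF l]
  have kr: "k \<cdot> r \<in> Hom \<C> P S" and le: "l \<cdot> e \<in> Hom \<C> P S" and em: "e \<cdot> m \<in> Hom \<C> C D"
    using Cmp_in m e r k l by blast+
  have lem: "l \<cdot> (e \<cdot> m) \<in> Hom \<C> C S" using Cmp_in[OF em l] .
  show ?thesis
  proof (rule is_pushoutI[OF em m Add_in[OF kr le] l])
    have "(k \<cdot> r) \<cdot> m = zm \<C> C S"
      using Cmp_assoc[OF m r k] is_cokernel_zero[OF cok m r] Cmp_zm[OF k] ob by simp
    then show "l \<cdot> (e \<cdot> m) = ((k \<cdot> r) \<oplus> (l \<cdot> e)) \<cdot> m"
      using Cmp_Add_left[OF m kr le] Cmp_assoc[OF m e l] zm_Add[OF lem] by simp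
  next
    fix s t T
    assume s: "s \<in> Hom \<C> P T" and t: "t \<in> Hom \<C> D T" and eq: "t \<cdot> (e \<cdot> m) = s \<cdot> m"
    have te: "t \<cdot> e \<in> Hom \<C> P T" using Cmp_in[OF e t] .
    have eval: "u \<cdot> ((k \<cdot> r) \<oplus> (l \<cdot> e)) = ((u \<cdot> k) \<cdot> r) \<oplus> ((u \<cdot> l) \<cdot> e)" if u: "u \<in> Hom \<C> S T" for u
      using Cmp_Add_right[OF kr le u] Cmp_assoc[OF r k u] Cmp_assoc[OF e l u] by simp
    \<comment> \<open>Here \<open>x\<close> is s - t e, the part of \<open>s\<close> that must come
      from the summand \<open>R\<close>.\<close>
    obtain x where x: "x \<in> Hom \<C> P T" "x \<oplus> (t \<cdot> e) = s"
      using Add_difference[OF s te] .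
    have xm: "x \<cdot> m \<in> Hom \<C> C T" and sm: "s \<cdot> m \<in> Hom \<C> C T" and zCT: "zm \<C> C T \<in> Hom \<C> C T"
      using Cmp_in m x(1) s zm_in ob Hom_Ob[OF s] by blast+
    \<comment> \<open>Since s m = t e m, the left side is (x + t e) m = s m. Cancelling gives x m =
      0, so \<open>x\<close> factors through the cokernel \<open>r\<close>.\<close>
    have "(x \<cdot> m) \<oplus> (s \<cdot> m) = zm \<C> C T \<oplus> (s \<cdot> m)"
      using Cmp_Add_left[OF m x(1) te] x(2) Cmp_assoc[OF m e t] eq zm_Add[OF sm] by simp
    then have "x \<cdot> m = zm \<C> C T"
      using xm sm zCT by (blast intro: Add_right_cancel)
    then obtain w where w: "w \<in> Hom \<C> R T" "w \<cdot> r = x"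
      using is_cokernel_factor[OF cok m r x(1)] by blast
    \<comment> \<open>The copairing of \<open>w\<close> and \<open>t\<close> on the
      biproduct.\<close>
    let ?u = "(w \<cdot> p) \<oplus> (t \<cdot> q)"
    have wp: "w \<cdot> p \<in> Hom \<C> S T" and tq: "t \<cdot> q \<in> Hom \<C> S T"
      using Cmp_in p q w(1) t by blast+
    have u: "?u \<in> Hom \<C> S T" using Add_in[OF wp tq] .
    have uk: "?u \<cdot> k = w"
      using Cmp_Add_left[OF k wp tq] Cmp_assoc[OF k p w(1)] Cmp_assoc[OF k q t] pk qk
        idm_right[OF w(1)] Cmp_zm[OF t] Add_zm[OF w(1)] ob by simp
    have ul: "?u \<cdot> l = t"
      using Cmp_Add_left[OF l wp tq] Cmp_assoc[OF l p w(1)] Cmp_assoc[OF l q t] pl ql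
        idm_right[OF t] Cmp_zm[OF w(1)] zm_Add[OF t] ob by simp
    show "\<exists>!u. u \<in> Hom \<C> S T \<and> u \<cdot> ((k \<cdot> r) \<oplus> (l \<cdot> e)) = s \<and> u \<cdot> l = t"
    proof (intro ex1I conjI)
      show "?u \<in> Hom \<C> S T" "?u \<cdot> l = t" by (fact u ul)+
      show "?u \<cdot> ((k \<cdot> r) \<oplus> (l \<cdot> e)) = s"
        using eval[OF u] uk ul w(2) x(2) by simp
    next
      fix v
      assume v: "v \<in> Hom \<C> S T \<and> v \<cdot> ((k \<cdot> r) \<oplus> (l \<cdot> e)) = s \<and> v \<cdot> l = t"
      then have vH: "v \<in> Hom \<C> S T" by blast
      have vk: "v \<cdot> k \<in> Hom \<C> R T" using Cmp_in[OF k vH] .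
      have vkr: "(v \<cdot> k) \<cdot> r \<in> Hom \<C> P T" using Cmp_in[OF r vk] .
      have "((v \<cdot> k) \<cdot> r) \<oplus> (t \<cdot> e) = x \<oplus> (t \<cdot> e)"
        using eval[OF vH] v x(2) by simp
      then have "(v \<cdot> k) \<cdot> r = w \<cdot> r"
        using Add_right_cancel[OF vkr x(1) te] w(2) by simp
      then have "v \<cdot> k = w" using is_cokernel_epi[OF cok m r vk w(1)] by simp
      \<comment> \<open>Expanding the identity of \<open>S\<close> recovers \<open>v\<close> from
        its restrictions to the two summands, which are now known to be \<open>w\<close> and
        \<open>t\<close>.\<close>
      moreover have "v = ((v \<cdot> k) \<cdot> p) \<oplus> ((v \<cdot> l) \<cdot> q)"
        using Cmp_Add_right[OF Cmp_in[OF p k] Cmp_in[OF q l] vH] sum idm_right[OF vH]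
          Cmp_assoc[OF p k vH] Cmp_assoc[OF q l vH] by simp
      ultimately show "v = ?u" using v by simp
    qed
  qed
qed

text \<open>A morphism out of B'' that kills \<open>i''\<close> is pulled back along
  \<open>g'\<close>, descends along \<open>d'\<close> to C', and then along \<open>h'\<close> to
  C''. Each equation is checked after composing with a cokernel, which is epi.\<close>

lemma third_row_cokernel:
  assumes i: "i \<in> Hom \<C> A B" and d: "d \<in> Hom \<C> B C"
    and i': "i' \<in> Hom \<C> A' B'" and d': "d' \<in> Hom \<C> B' C'"
    and i'': "i'' \<in> Hom \<C> A'' B''" and d'': "d'' \<in> Hom \<C> B'' C''"
    and f: "f \<in> Hom \<C> A A'" and f': "f' \<in> Hom \<C> A' A''"
    and g: "g \<in> Hom \<C> B B'" and g': "g' \<in> Hom \<C> B' B''"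
    and h: "h \<in> Hom \<C> C C'" and h': "h' \<in> Hom \<C> C' C''"
    and hd: "h \<cdot> d = d' \<cdot> g"
    and gi': "g' \<cdot> i' = i'' \<cdot> f'" and hd': "h' \<cdot> d' = d'' \<cdot> g'"
    and cf: "is_cokernel \<C> f' f" and cg: "is_cokernel \<C> g' g" and ch: "is_cokernel \<C> h' h"
    and ci: "is_cokernel \<C> d i" and ci': "is_cokernel \<C> d' i'"
  shows "is_cokernel \<C> d'' i''"
proof (rule is_cokernelI[OF i'' d''])
  note ob = Hom_Ob[OF i] Hom_Ob[OF i'] Hom_Ob[OF i''] Hom_Ob[OF h] Hom_Ob[OF h']
  have di: "d'' \<cdot> i'' \<in> Hom \<C> A'' C''" and z: "zm \<C> A'' C'' \<in> Hom \<C> A'' C''"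
    using Cmp_in[OF i'' d''] zm_in ob by blast+
  have "(d'' \<cdot> i'') \<cdot> f' = h' \<cdot> (d' \<cdot> i')"
    using Cmp_assoc[OF f' i'' d''] Cmp_assoc[OF i' g' d''] Cmp_assoc[OF i' d' h'] gi' hd' by simp
  also have "\<dots> = zm \<C> A'' C'' \<cdot> f'"
    using is_cokernel_zero[OF ci' i' d'] Cmp_zm[OF h'] zm_Cmp[OF f'] ob by simp
  finally show "d'' \<cdot> i'' = zm \<C> A'' C''"
    using is_cokernel_epi[OF cf f f' di z] by blast
next
  fix t T
  assume t: "t \<in> Hom \<C> B'' T" and ti: "t \<cdot> i'' = zm \<C> A'' T"
  note ob = Hom_Ob[OF i] Hom_Ob[OF i'] Hom_Ob[OF i''] Hom_Ob[OF h] Hom_Ob[OF h'] Hom_Ob[OF t]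
  have tg: "t \<cdot> g' \<in> Hom \<C> B' T" using Cmp_in[OF g' t] .
  have "(t \<cdot> g') \<cdot> i' = zm \<C> A' T"
    using Cmp_assoc[OF i' g' t] gi' Cmp_assoc[OF f' i'' t] ti zm_Cmp[OF f'] ob by simp
  then obtain s where s: "s \<in> Hom \<C> C' T" "s \<cdot> d' = t \<cdot> g'"
    using is_cokernel_factor[OF ci' i' d' tg] by blast
  have sh: "s \<cdot> h \<in> Hom \<C> C T" and z: "zm \<C> C T \<in> Hom \<C> C T"
    using Cmp_in[OF h s(1)] zm_in ob by blast+
  \<comment> \<open>To descend \<open>s\<close> along \<open>h'\<close>, s h = 0 is tested on the
    epimorphism \<open>d\<close>: s h d = s d' g = t g' g = 0.\<close>
  have "(s \<cdot> h) \<cdot> d = t \<cdot> (g' \<cdot> g)"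
    using Cmp_assoc[OF d h s(1)] hd Cmp_assoc[OF g d' s(1)] s(2) Cmp_assoc[OF g g' t] by simp
  also have "\<dots> = zm \<C> C T \<cdot> d"
    using is_cokernel_zero[OF cg g g'] Cmp_zm[OF t] zm_Cmp[OF d] ob by simp
  finally have "s \<cdot> h = zm \<C> C T" using is_cokernel_epi[OF ci i d sh z] by blast
  then obtain u where u: "u \<in> Hom \<C> C'' T" "u \<cdot> h' = s"
    using is_cokernel_factor[OF ch h h' s(1)] by blast
  have "(u \<cdot> d'') \<cdot> g' = t \<cdot> g'"
    using Cmp_assoc[OF g' d'' u(1)] hd' Cmp_assoc[OF d' h' u(1)] u(2) s(2) by simp
  then have "u \<cdot> d'' = t"
    using is_cokernel_epi[OF cg g g' Cmp_in[OF d'' u(1)] t] by blast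
  with u(1) show "\<exists>u \<in> Hom \<C> C'' T. u \<cdot> d'' = t" by blast
next
  fix u v T
  assume u: "u \<in> Hom \<C> C'' T" and v: "v \<in> Hom \<C> C'' T" and eq: "u \<cdot> d'' = v \<cdot> d''"
  \<comment> \<open>Both \<open>h'\<close> and \<open>d'\<close> are epi, and h' d' = d'' g', so
    \<open>d''\<close> is epi as well.\<close>
  have "(u \<cdot> h') \<cdot> d' = (v \<cdot> h') \<cdot> d'"
    using Cmp_assoc[OF d' h' u] Cmp_assoc[OF d' h' v] hd' eq
      Cmp_assoc[OF g' d'' u] Cmp_assoc[OF g' d'' v] by simp
  then have "u \<cdot> h' = v \<cdot> h'"
    using is_cokernel_epi[OF ci' i' d' Cmp_in[OF h' u] Cmp_in[OF h' v]] by blast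
  then show "u = v" using is_cokernel_epi[OF ch h h' u v] by blast
qed

end

theorem proposition5p11:
  fixes \<C> :: "('o, 'm, 'x) preadditive_category_scheme" (structure)
    and Infl :: "'m set"
    and A B C A' B' C' A'' B'' C'' :: 'o
    and i d i' d' i'' d'' f f' g g' h h' :: 'm
  assumes "strongly_right_exact_category \<C> Infl"
    and "i \<in> Hom \<C> A B" and "d \<in> Hom \<C> B C"
    and "i' \<in> Hom \<C> A' B'" and "d' \<in> Hom \<C> B' C'"
    and "i'' \<in> Hom \<C> A'' B''" and "d'' \<in> Hom \<C> B'' C''"
    and "f \<in> Hom \<C> A A'" and "f' \<in> Hom \<C> A' A''"
    and "g \<in> Hom \<C> B B'" and "g' \<in> Hom \<C> B' B''"
    and "h \<in> Hom \<C> C C'" and "h' \<in> Hom \<C> C' C''"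
    and "g \<cdot> i = i' \<cdot> f" and "h \<cdot> d = d' \<cdot> g"
    and "g' \<cdot> i' = i'' \<cdot> f'" and "h' \<cdot> d' = d'' \<cdot> g'"
    and "conflation \<C> Infl f f'" and "conflation \<C> Infl g g'" and "conflation \<C> Infl h h'"
    and "conflation \<C> Infl i d" and "conflation \<C> Infl i' d'"
  shows "conflation \<C> Infl i'' d''"
proof -
  interpret strongly_right_exact_category \<C> Infl by fact
  note i = assms(2) and d = assms(3) and i' = assms(4) and d' = assms(5)
    and i'' = assms(6) and d'' = assms(7) and f = assms(8) and f' = assms(9)
    and g = assms(10) and g' = assms(11) and h = assms(12) and h' = assms(13)
    and gi = assms(14) and hd = assms(15) and gi' = assms(16) and hd' = assms(17)
  note ob = Hom_Ob[OF i] Hom_Ob[OF i'] Hom_Ob[OF i''] Hom_Ob[OF h] Hom_Ob[OF h']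
  have cf: "is_cokernel \<C> f' f" and cg: "is_cokernel \<C> g' g" and ch: "is_cokernel \<C> h' h"
    and ci: "is_cokernel \<C> d i" and ci': "is_cokernel \<C> d' i'"
    and h_infl: "h \<in> Infl" and i'_infl: "i' \<in> Infl"
    using assms(18-22) by (simp_all add: conflation_def)
  have cok: "is_cokernel \<C> d'' i''"
    by (rule third_row_cokernel[OF i d i' d' i'' d'' f f' g g' h h' hd gi' hd' cf cg ch ci ci'])

  \<comment> \<open>The pushout \<open>P\<close> and its induced morphisms\<close>
  obtain j q where po: "is_pushout \<C> i' f' j q"
    using R2_exists[OF i'_infl, of f'] HomD[OF f'] HomD[OF i'] by metis
  then have j_infl: "j \<in> Infl" using R2_inflation i'_infl by blast
  define P where "P = Cod \<C> j"
  note po_univ = is_pushout_universal[OF po i' f', folded P_def]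
  have j: "j \<in> Hom \<C> A'' P" and q: "q \<in> Hom \<C> B' P" and sq: "q \<cdot> i' = j \<cdot> f'"
    using is_pushout_Hom[OF po i' f'] is_pushout_commutes[OF po i' f'] by (simp_all add: P_def)
  \<comment> \<open>Both sides are zero, so 0 and d' form a cocone on the pushout span; it induces
    \<open>e\<close>.\<close>
  have "d' \<cdot> i' = zm \<C> A'' C' \<cdot> f'"
    using is_cokernel_zero[OF ci' i' d'] zm_Cmp[OF f'] ob by simp
  then obtain e where e: "e \<in> Hom \<C> P C'" and ej: "e \<cdot> j = zm \<C> A'' C'" and eq: "e \<cdot> q = d'"
    using po_univ[OF zm_in d'] ob by blast
  obtain r where r: "r \<in> Hom \<C> P B''" and rj: "r \<cdot> j = i''" and rq: "r \<cdot> q = g'"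
    using po_univ[OF i'' g' gi'] by blast
  have qg: "q \<cdot> g \<in> Hom \<C> B P" using Cmp_in[OF g q] .
  \<comment> \<open>q g i = q i' f = j f' f = 0, so q g descends along \<open>d\<close> to the
    morphism \<open>m\<close>.\<close>
  have "(q \<cdot> g) \<cdot> i = (j \<cdot> f') \<cdot> f"
    using Cmp_assoc[OF i g q] gi Cmp_assoc[OF f i' q] sq by simp
  also have "\<dots> = zm \<C> A P"
    using Cmp_assoc[OF f f' j] is_cokernel_zero[OF cf f f'] Cmp_zm[OF j] ob by simp
  finally obtain m where m: "m \<in> Hom \<C> C P" and md: "m \<cdot> d = q \<cdot> g"
    using is_cokernel_factor[OF ci i d qg] by blast
  have "(e \<cdot> m) \<cdot> d = h \<cdot> d"
    using Cmp_assoc[OF d m e] md Cmp_assoc[OF g q e] eq hd by simp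
  then have em: "e \<cdot> m = h"
    using is_cokernel_epi[OF ci i d Cmp_in[OF m e] h] by blast

  \<comment> \<open>The cokernel of \<open>m\<close>\<close>
  have r_cok: "is_cokernel \<C> r m"
  proof (rule is_cokernelI[OF m r])
    have "(r \<cdot> m) \<cdot> d = zm \<C> C B'' \<cdot> d"
      using Cmp_assoc[OF d m r] md Cmp_assoc[OF g q r] rq is_cokernel_zero[OF cg g g']
        zm_Cmp[OF d] ob by simp
    then show "r \<cdot> m = zm \<C> C B''"
      using is_cokernel_epi[OF ci i d Cmp_in[OF m r]] zm_in ob by blast
  next
    fix t T
    assume t: "t \<in> Hom \<C> P T" and tm: "t \<cdot> m = zm \<C> C T"
    have tq: "t \<cdot> q \<in> Hom \<C> B' T" and tj: "t \<cdot> j \<in> Hom \<C> A'' T"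
      using Cmp_in t q j by blast+
    \<comment> \<open>t q g = t m d = 0, so t q factors through the cokernel \<open>g'\<close> of
      \<open>g\<close>; the factor \<open>s\<close> is the candidate for factoring \<open>t\<close>
      through \<open>r\<close>.\<close>
    have "(t \<cdot> q) \<cdot> g = zm \<C> B T"
      using Cmp_assoc[OF g q t] md Cmp_assoc[OF d m t] tm zm_Cmp[OF d] Hom_Ob[OF t] by simp
    then obtain s where s: "s \<in> Hom \<C> B'' T" and sg: "s \<cdot> g' = t \<cdot> q"
      using is_cokernel_factor[OF cg g g' tq] by blast
    \<comment> \<open>Both sides equal t q i'. Cancelling the epimorphism \<open>f'\<close> shows
      that s r and t agree on the leg \<open>j\<close>; they agree on \<open>q\<close> by the choice
      of \<open>s\<close>, hence on all of \<open>P\<close>.\<close>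
    have "(s \<cdot> i'') \<cdot> f' = (t \<cdot> j) \<cdot> f'"
      using Cmp_assoc[OF f' i'' s] gi' Cmp_assoc[OF i' g' s] sg Cmp_assoc[OF i' q t] sq
        Cmp_assoc[OF f' j t] by simp
    then have "s \<cdot> i'' = t \<cdot> j"
      using is_cokernel_epi[OF cf f f' Cmp_in[OF i'' s] tj] by blast
    then have "(s \<cdot> r) \<cdot> j = t \<cdot> j" "(s \<cdot> r) \<cdot> q = t \<cdot> q"
      using Cmp_assoc[OF j r s] Cmp_assoc[OF q r s] rj rq sg by simp_all
    moreover have "(t \<cdot> q) \<cdot> i' = (t \<cdot> j) \<cdot> f'"
      using Cmp_assoc[OF i' q t] Cmp_assoc[OF f' j t] sq by simp
    ultimately have "s \<cdot> r = t"
      using po_univ[OF tj tq] Cmp_in[OF r s] t by blast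
    with s show "\<exists>u \<in> Hom \<C> B'' T. u \<cdot> r = t" by blast
  next
    fix u v T
    assume u: "u \<in> Hom \<C> B'' T" and v: "v \<in> Hom \<C> B'' T" and "u \<cdot> r = v \<cdot> r"
    \<comment> \<open>g' = r q is epi, hence so is \<open>r\<close>.\<close>
    then have "u \<cdot> g' = v \<cdot> g'"
      using Cmp_assoc[OF q r u] Cmp_assoc[OF q r v] rq by simp
    then show "u = v" using is_cokernel_epi[OF cg g g' u v] by blast
  qed

  \<comment> \<open>The inflation property of \<open>i''\<close>\<close>
  obtain S k l p p' where bip: "is_biproduct \<C> B'' C' S k l p p'"
    using biproduct_exists ob by blast
  then have k: "k \<in> Hom \<C> B'' S" and l: "l \<in> Hom \<C> C' S"
    unfolding is_biproduct_def by auto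
  let ?n = "(k \<cdot> r) \<oplus> (l \<cdot> e)"
  have kr: "k \<cdot> r \<in> Hom \<C> P S" and le: "l \<cdot> e \<in> Hom \<C> P S" and ki: "k \<cdot> i'' \<in> Hom \<C> A'' S"
    using Cmp_in r e i'' k l by blast+
  have n: "?n \<in> Hom \<C> P S" using Add_in[OF kr le] .
  \<comment> \<open>The identity e m = h is what turns the general square on e m into a pushout of
    the inflation \<open>h\<close>, so \<open>[R2]\<close> makes (r, e) an inflation.\<close>
  have "is_pushout \<C> h m ?n l"
    using is_pushout_cokernel_biproduct[OF m e r r_cok bip] em by simp
  then have "?n \<in> Infl" using R2_inflation h_infl by blast
  then have "?n \<cdot> j \<in> Infl" using R1 j_infl HomD[OF j] HomD[OF n] by simp
  \<comment> \<open>The C' component vanishes because e j = 0, leaving the pair (i'', 0).\<close>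
  moreover have "?n \<cdot> j = k \<cdot> i''"
    using Cmp_Add_left[OF j kr le] Cmp_assoc[OF j r k] Cmp_assoc[OF j e l] rj ej
      Cmp_zm[OF l] Add_zm[OF ki] ob by simp
  \<comment> \<open>\<open>[R3]\<close> is applied with the biproduct inclusion \<open>k\<close> as
    second factor; the cokernel it asks for is \<open>d''\<close>.\<close>
  ultimately have "i'' \<in> Infl" using R3[OF i'' k] cok by auto
  with cok show ?thesis by (simp add: conflation_def)
qed

end
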